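(* If $t\ge 3$ is an integer and $t\ne 4$, then $$\operatorname{gp}(C_8\boxtimes C_t)=9.$$
   Context: All graphs are finite, simple and connected. $d_G(u,v)$ is the usual shortest-path distance in $G$. A set $S\subseteq V(G)$ is a general position set of $G$ if no vertex of $S$ lies on a shortest path between two other vertices of $S$; equivalently, $d_G(u,v)\ne d_G(u,w)+d_G(w,v)$ for all pairwise distinct $u,v,w\in S$. The general position number $\operatorname{gp}(G)$ is the maximum cardinality of a general position set of $G$. The strong product $G\boxtimes H$ has vertex set $V(G)\times V(H)$; distinct vertices $(u_x,u_y)$ and $(v_x,v_y)$ are adjacent if and only if ($u_x=v_x$ and $u_yv_y\in E(H)$), or ($u_y=v_y$ and $u_xv_x\in E(G)$), or ($u_xv_x\in E(G)$ and $u_yv_y\in E(H)$). $C_n$ is the cycle on $n$ vertices. *)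

theory Defs
  imports "Graph_Theory.Graph_Theory"
begin

text \<open>
  A finite simple graph is a \<^locale>\<open>pair_graph\<close>: each undirected edge is represented by its two
  orientations in \<^const>\<open>parcs\<close>. Distances are the minimum walk costs for unit arc weights, so
  they are \<open>\<infinity>\<close> between vertices of different components.
\<close>

definition graph_dist :: "'a pair_pre_digraph \<Rightarrow> 'a \<Rightarrow> 'a \<Rightarrow> ereal" where
  "graph_dist G u v = wf_digraph.\<mu> (with_proj G) (\<lambda>_. 1) u v"

definition shortest_path :: "'a pair_pre_digraph \<Rightarrow> 'a \<Rightarrow> ('a \<times> 'a) awalk \<Rightarrow> 'a \<Rightarrow> bool" where
  "shortest_path G u p v \<longleftrightarrow>
     pre_digraph.apath (with_proj G) u p v \<and> ereal (length p) = graph_dist G u v"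

definition general_position :: "'a pair_pre_digraph \<Rightarrow> 'a set \<Rightarrow> bool" where
  "general_position G S \<longleftrightarrow> S \<subseteq> pverts G \<and>
     (\<forall>u\<in>S. \<forall>v\<in>S. \<forall>w\<in>S. u \<noteq> v \<and> w \<noteq> u \<and> w \<noteq> v \<longrightarrow>
        \<not> (\<exists>p. shortest_path G u p v \<and> w \<in> set (pawalk_verts u p)))"

definition gp_number :: "'a pair_pre_digraph \<Rightarrow> nat" where
  "gp_number G = Max (card ` {S. general_position G S})"

definition strong_product ::
    "'a pair_pre_digraph \<Rightarrow> 'b pair_pre_digraph \<Rightarrow> ('a \<times> 'b) pair_pre_digraph"  (infixl "\<boxtimes>" 70)
  where
  "G \<boxtimes> H = \<lparr> pverts = pverts G \<times> pverts H,
     parcs = {((ux, uy), (vx, vy)).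
       ux \<in> pverts G \<and> vx \<in> pverts G \<and> uy \<in> pverts H \<and> vy \<in> pverts H \<and>
       (ux = vx \<and> (uy, vy) \<in> parcs H \<or>
        uy = vy \<and> (ux, vx) \<in> parcs G \<or>
        (ux, vx) \<in> parcs G \<and> (uy, vy) \<in> parcs H)} \<rparr>"

text \<open>
  This is the cycle \<open>C\<^sub>n\<close> only for \<open>n \<ge> 3\<close>; for \<open>n = 1\<close> it has a loop and for \<open>n = 2\<close> it is a
  single edge.
\<close>
definition cycle_graph :: "nat \<Rightarrow> nat pair_pre_digraph" where
  "cycle_graph n = \<lparr> pverts = {0..<n},
     parcs = {(i, j). i < n \<and> j < n \<and> (j = (i + 1) mod n \<or> i = (j + 1) mod n)} \<rparr>"


lemma pair_graphI:
  assumes "finite (pverts G)"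
    and wf: "\<And>u v. (u, v) \<in> parcs G \<Longrightarrow> u \<in> pverts G \<and> v \<in> pverts G \<and> u \<noteq> v \<and> (v, u) \<in> parcs G"
  shows "pair_graph G"
proof
  have "parcs G \<subseteq> pverts G \<times> pverts G" using wf by auto
  then show "finite (parcs G)" using assms(1) finite_subset by blast
  show "symmetric (with_proj G)"
    using wf by (auto simp: symmetric_def intro!: symI)
qed (use assms in force)+

lemma pair_graph_arcD:
  assumes "pair_graph G" and "(u, v) \<in> parcs G"
  shows "u \<in> pverts G" "v \<in> pverts G" "u \<noteq> v" "(v, u) \<in> parcs G"
proof -
  interpret pair_graph G by fact
  show "u \<in> pverts G" "v \<in> pverts G" "u \<noteq> v" 
    using assms(2) in_arcsD1 in_arcsD2 pair_no_loops by fastforce+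
  show "(v, u) \<in> parcs G"
    using pair_sym_arcs assms(2) by (auto simp: symmetric_def dest: symD)
qed

lemma pair_graph_cycle_graph:
  assumes "n \<ge> 3"
  shows "pair_graph (cycle_graph n)"
proof (rule pair_graphI)
  have *: "Suc i mod n \<noteq> i" if "i < n" for i
    using that assms by (cases "i + 1 = n") auto
  show "u \<in> pverts (cycle_graph n) \<and> v \<in> pverts (cycle_graph n) \<and> u \<noteq> v
          \<and> (v, u) \<in> parcs (cycle_graph n)"
    if "(u, v) \<in> parcs (cycle_graph n)" for u v
    using that *[of u] *[of v] by (auto simp: cycle_graph_def)
qed (simp add: cycle_graph_def)

lemma pair_graph_strong_product:
  assumes "pair_graph G" and "pair_graph H"
  shows "pair_graph (G \<boxtimes> H)"
proof (rule pair_graphI)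
  have "finite (pverts G)" "finite (pverts H)"
    using assms by (auto simp: pair_graph_def pair_digraph_def pair_fin_digraph_def
        pair_fin_digraph_axioms_def)
  then show "finite (pverts (G \<boxtimes> H))" by (simp add: strong_product_def)
  show "u \<in> pverts (G \<boxtimes> H) \<and> v \<in> pverts (G \<boxtimes> H) \<and> u \<noteq> v \<and> (v, u) \<in> parcs (G \<boxtimes> H)"
    if "(u, v) \<in> parcs (G \<boxtimes> H)" for u v
    using that by (auto simp: strong_product_def dest: pair_graph_arcD(3)[OF assms(1)]
        pair_graph_arcD(3)[OF assms(2)] intro: pair_graph_arcD(4)[OF assms(1)]
        pair_graph_arcD(4)[OF assms(2)])
qed

lemma graph_dist_path:
  assumes "pair_graph G" and "reachable (with_proj G) u v"
  shows "\<exists>p. shortest_path G u p v"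
proof -
  interpret pair_graph G by fact
  have "awalk_cost (\<lambda>_. 1) p = length p" for p
    by (simp add: awalk_cost_def sum_list_triv)
  then show ?thesis
    using min_cost_awalk[OF assms(2), of "\<lambda>_. 1"]
    by (auto simp: shortest_path_def graph_dist_def)
qed

lemma graph_dist_le:
  assumes "pair_graph G" and "pre_digraph.awalk (with_proj G) u p v"
  shows "graph_dist G u v \<le> ereal (length p)"
proof -
  interpret pair_graph G by fact
  have "awalk_cost (\<lambda>_. 1) p = length p" for p
    by (simp add: awalk_cost_def sum_list_triv)
  then show ?thesis
    using min_cost_le_walk_cost[OF assms(2), of "\<lambda>_. 1"] by (simp add: graph_dist_def)
qed

lemma on_shortest_path_iff:
  assumes G: "pair_graph G"
    and r: "reachable (with_proj G) u w" "reachable (with_proj G) w v"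
  shows "(\<exists>p. shortest_path G u p v \<and> w \<in> set (pawalk_verts u p))
    \<longleftrightarrow> graph_dist G u v = graph_dist G u w + graph_dist G w v"
proof -
  interpret pair_graph G by fact
  obtain q1 q2 where q: "shortest_path G u q1 w" "shortest_path G w q2 v"
    using graph_dist_path[OF G] r by blast
  then have qa: "awalk u q1 w" "awalk w q2 v"
    and qd: "graph_dist G u w = ereal (length q1)" "graph_dist G w v = ereal (length q2)"
    by (simp_all add: shortest_path_def apath_def)
  show ?thesis
  proof
    assume "\<exists>p. shortest_path G u p v \<and> w \<in> set (pawalk_verts u p)"
    then obtain p where p: "shortest_path G u p v" "w \<in> set (pawalk_verts u p)" by blast
    have pa: "awalk u p v" using p(1) by (auto simp: shortest_path_def apath_def)
    obtain p1 p2 where "p = p1 @ p2" "awalk u p1 w" "awalk w p2 v"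
      using awalk_decomp[OF pa p(2)] by blast
    then have "graph_dist G u w + graph_dist G w v \<le> graph_dist G u v"
      using p(1) add_mono[OF graph_dist_le[OF G, of u p1 w] graph_dist_le[OF G, of w p2 v]]
      by (simp add: shortest_path_def flip: plus_ereal.simps)
    moreover have "graph_dist G u v \<le> graph_dist G u w + graph_dist G w v"
      using graph_dist_le[OF G awalk_appendI[OF qa]] by (simp flip: plus_ereal.simps add: qd)
    ultimately show "graph_dist G u v = graph_dist G u w + graph_dist G w v" by simp
  next
    assume eq: "graph_dist G u v = graph_dist G u w + graph_dist G w v"
    let ?p = "q1 @ q2"
    have aw: "awalk u ?p v" using qa by (rule awalk_appendI)
    have len: "ereal (length ?p) = graph_dist G u v"
      using eq by (simp add: qd)
    have "distinct (pawalk_verts u ?p)"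
    proof (rule ccontr)
      assume nd: "\<not> distinct (pawalk_verts u ?p)"
      obtain q r s x where dec: "?p = q @ r @ s" "closed_w r" "awalk u q x" "awalk x s v"
        by (rule awalk_cyc_decompE'[OF aw nd]) blast
      have "length (q @ s) < length ?p"
        unfolding dec(1) using dec(2) by (simp add: closed_w_def)
      moreover have "ereal (length ?p) \<le> ereal (length (q @ s))"
        unfolding len by (rule graph_dist_le[OF G awalk_appendI[OF dec(3,4)]])
      ultimately show False by simp
    qed
    with aw len have "shortest_path G u ?p v" by (auto simp: shortest_path_def apath_def)
    moreover have "w \<in> set (pawalk_verts u ?p)"
      unfolding set_awalk_verts_append[OF qa] using set_awalk_verts[OF qa(2)] by simp
    ultimately show "\<exists>p. shortest_path G u p v \<and> w \<in> set (pawalk_verts u p)" by blast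
  qed
qed

lemma general_position_iff_dist:
  assumes "pair_graph G" and "strongly_connected (with_proj G)"
  shows "general_position G S \<longleftrightarrow> S \<subseteq> pverts G \<and>
    (\<forall>u\<in>S. \<forall>v\<in>S. \<forall>w\<in>S. u \<noteq> v \<and> w \<noteq> u \<and> w \<noteq> v \<longrightarrow>
       graph_dist G u v \<noteq> graph_dist G u w + graph_dist G w v)"
proof -
  have r: "reachable (with_proj G) u v" if "u \<in> pverts G" "v \<in> pverts G" for u v
    using assms(2) that by (auto simp: strongly_connected_def)
  show ?thesis
    unfolding general_position_def
    by (intro conj_cong refl ball_cong imp_cong arg_cong[where f=Not]
        on_shortest_path_iff[OF assms(1)] r) auto
qed

end

theory Submission
  imports Defs
begin

text \<open>
  The distance in a strong product is the larger of the two coordinate distances.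

  If \<open>A\<close> and \<open>B\<close> are in general position in the factors, then so is \<open>A \<times> B\<close>: on a geodesic from
  \<open>u\<close> to \<open>v\<close> through \<open>w\<close>, the coordinate that realises the distance of \<open>u\<close> and \<open>v\<close> also has \<open>w\<close>
  strictly between them, contradicting general position in that factor (\<open>gp_set_times\<close>). Three
  points that cut a cycle into arcs shorter than half its length are in general position, and such
  points exist in every cycle except \<open>C\<^sub>4\<close>. This gives 9 vertices.

  For the upper bound, look at a window of 5 consecutive vertices of \<open>C\<^sub>8\<close>. It is isometric to a
  path, so its vertices carry a linear coordinate \<open>p\<close>. On the points of a general position set
  \<open>S\<close> over the window, the relation ``the increase of \<open>p\<close> from \<open>u\<close> to \<open>v\<close> is at least their distance
  in \<open>C\<^sub>t\<close>'' is a partial order. A chain of three points would have its middle point on a geodesic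
  of its ends, so chains have at most two points. On an antichain all distances are distances in
  \<open>C\<^sub>t\<close>, so it projects injectively to a general position set of \<open>C\<^sub>t\<close>, which has at most three
  points. A poset of height at most 2 is a union of two antichains, so \<open>S\<close> has at most 6 points
  over each window (\<open>card_gp_set_path_product\<close>). Each point of \<open>S\<close> lies over 5 of the 8 windows,
  hence \<open>5 |S| \<le> 48\<close> and \<open>|S| \<le> 9\<close>.
\<close>

section \<open>Graph metrics\<close>

text \<open>
  Conditions along single arcs that force \<open>D\<close> to be the distance function of a connected graph: an
  arc lowers the value by at most one, which bounds every walk from below, and some arc lowers it
  by exactly one, which yields a walk of that length. Checking them for an explicit formula avoids
  any reasoning about walks.
\<close>
definition graph_metric :: "'a pair_pre_digraph \<Rightarrow> ('a \<Rightarrow> 'a \<Rightarrow> nat) \<Rightarrow> bool" where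
  "graph_metric G D \<longleftrightarrow>
     (\<forall>u\<in>pverts G. \<forall>v\<in>pverts G. D u v = 0 \<longleftrightarrow> u = v) \<and>
     (\<forall>u\<in>pverts G. \<forall>v\<in>pverts G. D u v = D v u) \<and>
     (\<forall>u u'. (u, u') \<in> parcs G \<longrightarrow> (\<forall>v\<in>pverts G. D u v \<le> D u' v + 1)) \<and>
     (\<forall>u\<in>pverts G. \<forall>v\<in>pverts G. u \<noteq> v \<longrightarrow> (\<exists>u'. (u, u') \<in> parcs G \<and> D u v = D u' v + 1))"

lemma graph_metricD:
  assumes "graph_metric G D"
  shows "u \<in> pverts G \<Longrightarrow> v \<in> pverts G \<Longrightarrow> D u v = 0 \<longleftrightarrow> u = v"
    and "u \<in> pverts G \<Longrightarrow> v \<in> pverts G \<Longrightarrow> D u v = D v u"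
    and "(u, u') \<in> parcs G \<Longrightarrow> v \<in> pverts G \<Longrightarrow> D u v \<le> D u' v + 1"
    and "u \<in> pverts G \<Longrightarrow> v \<in> pverts G \<Longrightarrow> u \<noteq> v \<Longrightarrow>
           \<exists>u'. (u, u') \<in> parcs G \<and> D u v = D u' v + 1"
  using assms by (auto simp: graph_metric_def)

lemma graph_metric_walk:
  assumes G: "pair_graph G" and D: "graph_metric G D"
    and "u \<in> pverts G" and v: "v \<in> pverts G"
  shows "\<exists>p. pre_digraph.awalk (with_proj G) u p v \<and> length p = D u v"
proof -
  interpret pair_graph G by fact
  show ?thesis
    using \<open>u \<in> pverts G\<close>
  proof (induction "D u v" arbitrary: u)
    case 0
    then have "u = v" using graph_metricD(1)[OF D] v by metis
    then show ?case using 0 v by (intro exI[of _ "[]"]) (simp add: awalk_Nil_iff)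
  next
    case (Suc d)
    then have "u \<noteq> v" using graph_metricD(1)[OF D] v by (metis nat.distinct(1))
    then obtain u' where u': "(u, u') \<in> parcs G" "D u v = D u' v + 1"
      using graph_metricD(4)[OF D Suc.prems v] by blast
    then obtain p where "awalk u' p v" "length p = D u' v"
      using Suc pair_graph_arcD(2)[OF G u'(1)] by auto
    then show ?case
      using u' Suc.prems by (intro exI[of _ "(u, u') # p"]) (simp add: awalk_Cons_iff)
  qed
qed

lemma graph_metric_le_walk:
  assumes G: "pair_graph G" and D: "graph_metric G D"
    and "pre_digraph.awalk (with_proj G) u p v" and v: "v \<in> pverts G"
  shows "D u v \<le> length p"
proof -
  interpret pair_graph G by fact
  show ?thesis
    using assms(3)
  proof (induction p arbitrary: u)
    case Nil
    then show ?case using graph_metricD(1)[OF D v v] by (simp add: awalk_Nil_iff)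
  next
    case (Cons e p)
    then have "(u, snd e) \<in> parcs G" "awalk (snd e) p v"
      by (auto simp: awalk_Cons_iff)
    then show ?case using Cons.IH graph_metricD(3)[OF D _ v] by fastforce
  qed
qed

lemma graph_dist_eq_metric:
  assumes G: "pair_graph G" and D: "graph_metric G D"
    and u: "u \<in> pverts G" and v: "v \<in> pverts G"
  shows "graph_dist G u v = ereal (D u v)"
proof (rule antisym)
  interpret pair_graph G by fact
  obtain p where p: "awalk u p v" "length p = D u v"
    using graph_metric_walk[OF assms] by blast
  then show "graph_dist G u v \<le> ereal (D u v)" using graph_dist_le[OF G p(1)] by simp
  obtain q where "shortest_path G u q v"
    using graph_dist_path[OF G] p(1) reachable_awalk by blast
  then have "awalk u q v" "graph_dist G u v = ereal (length q)"
    by (auto simp: shortest_path_def apath_def)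
  then show "ereal (D u v) \<le> graph_dist G u v"
    using graph_metric_le_walk[OF G D _ v] by simp
qed

text \<open>
  Follow the arcs that decrease the distance from \<open>u\<close> to \<open>w\<close>; each changes the distance to \<open>v\<close> by
  at most one.
\<close>
lemma graph_metric_triangle:
  assumes D: "graph_metric G D" and G: "pair_graph G"
    and "u \<in> pverts G" "v \<in> pverts G" "w \<in> pverts G"
  shows "D u v \<le> D u w + D w v"
  using \<open>u \<in> pverts G\<close>
proof (induction "D u w" arbitrary: u)
  case 0
  then show ?case using graph_metricD(1)[OF D] assms by (metis add_0 order_refl)
next
  case (Suc d)
  then have "u \<noteq> w" using graph_metricD(1)[OF D] assms by (metis nat.distinct(1))
  then obtain u' where u': "(u, u') \<in> parcs G" "D u w = D u' w + 1"
    using graph_metricD(4)[OF D] Suc.prems assms by blast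
  then show ?case
    using Suc.hyps(1)[of u'] Suc.hyps(2) pair_graph_arcD(2)[OF G u'(1)]
      graph_metricD(3)[OF D u'(1) assms(4)] by simp
qed

definition gp_set :: "('a \<Rightarrow> 'a \<Rightarrow> nat) \<Rightarrow> 'a set \<Rightarrow> bool" where
  "gp_set D S \<longleftrightarrow>
     (\<forall>u\<in>S. \<forall>v\<in>S. \<forall>w\<in>S. u \<noteq> v \<and> w \<noteq> u \<and> w \<noteq> v \<longrightarrow> D u v \<noteq> D u w + D w v)"

lemma gp_setD:
  "gp_set D S \<Longrightarrow> u \<in> S \<Longrightarrow> v \<in> S \<Longrightarrow> w \<in> S \<Longrightarrow> u \<noteq> v \<Longrightarrow> w \<noteq> u \<Longrightarrow> w \<noteq> v \<Longrightarrow>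
   D u v \<noteq> D u w + D w v"
  unfolding gp_set_def by blast

lemma gp_set_subset: "gp_set D S \<Longrightarrow> T \<subseteq> S \<Longrightarrow> gp_set D T"
  unfolding gp_set_def by blast

lemma general_position_iff_gp_set:
  assumes G: "pair_graph G" and D: "graph_metric G D" and ne: "pverts G \<noteq> {}"
  shows "general_position G S \<longleftrightarrow> S \<subseteq> pverts G \<and> gp_set D S"
proof -
  interpret pair_graph G by fact
  have "strongly_connected (with_proj G)"
    using ne graph_metric_walk[OF G D] by (auto simp: strongly_connected_def reachable_awalk)
  then have "general_position G S \<longleftrightarrow> S \<subseteq> pverts G \<and>
    (\<forall>u\<in>S. \<forall>v\<in>S. \<forall>w\<in>S. u \<noteq> v \<and> w \<noteq> u \<and> w \<noteq> v \<longrightarrow>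
       graph_dist G u v \<noteq> graph_dist G u w + graph_dist G w v)"
    by (rule general_position_iff_dist[OF G])
  also have "\<dots> \<longleftrightarrow> S \<subseteq> pverts G \<and> gp_set D S"
    unfolding gp_set_def
    by (intro conj_cong refl ball_cong imp_cong)
      (auto simp: graph_dist_eq_metric[OF G D] subset_iff simp flip: of_nat_add)
  finally show ?thesis .
qed

section \<open>Strong products\<close>

definition max_metric ::
    "('a \<Rightarrow> 'a \<Rightarrow> nat) \<Rightarrow> ('b \<Rightarrow> 'b \<Rightarrow> nat) \<Rightarrow> 'a \<times> 'b \<Rightarrow> 'a \<times> 'b \<Rightarrow> nat" where
  "max_metric D E u v = max (D (fst u) (fst v)) (E (snd u) (snd v))"

text \<open>
  A step towards \<open>v\<close> that rests once \<open>v\<close> is reached; truncated subtraction covers both cases. In a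
  strong product the two coordinates make such steps simultaneously.
\<close>
lemma graph_metric_step:
  assumes G: "pair_graph G" and D: "graph_metric G D"
    and u: "u \<in> pverts G" and v: "v \<in> pverts G"
  shows "\<exists>u'\<in>pverts G. (u' = u \<and> u = v \<or> (u, u') \<in> parcs G) \<and> D u' v = D u v - 1"
proof (cases "u = v")
  case True
  then have "D u v = 0" using graph_metricD(1)[OF D u v] by simp
  then show ?thesis using True u by (intro bexI[of _ u]) simp_all
next
  case False
  then obtain u' where u': "(u, u') \<in> parcs G" "D u v = D u' v + 1"
    using graph_metricD(4)[OF D u v] by blast
  then show ?thesis
    using pair_graph_arcD(2)[OF G u'(1)] by (intro bexI[of _ u']) simp_all
qed

lemma graph_metric_strong_product:
  assumes G: "pair_graph G" and D: "graph_metric G D"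
    and H: "pair_graph H" and E: "graph_metric H E"
  shows "graph_metric (G \<boxtimes> H) (max_metric D E)"
proof -
  have V: "pverts (G \<boxtimes> H) = pverts G \<times> pverts H" by (simp add: strong_product_def)
  have "\<exists>u'. (u, u') \<in> parcs (G \<boxtimes> H) \<and> max_metric D E u v = max_metric D E u' v + 1"
    if uv: "u \<in> pverts (G \<boxtimes> H)" "v \<in> pverts (G \<boxtimes> H)" "u \<noteq> v" for u v
  proof -
    obtain ux uy vx vy where e: "u = (ux, uy)" "v = (vx, vy)" by fastforce
    have m: "ux \<in> pverts G" "uy \<in> pverts H" "vx \<in> pverts G" "vy \<in> pverts H"
      using uv by (auto simp: V e)
    obtain x where x: "x \<in> pverts G" "x = ux \<and> ux = vx \<or> (ux, x) \<in> parcs G"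
      "D x vx = D ux vx - 1" using graph_metric_step[OF G D m(1,3)] by blast
    obtain y where y: "y \<in> pverts H" "y = uy \<and> uy = vy \<or> (uy, y) \<in> parcs H"
      "E y vy = E uy vy - 1" using graph_metric_step[OF H E m(2,4)] by blast
    \<comment> \<open>The larger coordinate distance is positive, so the step really lowers it by one.\<close>
    have "max (D ux vx) (E uy vy) > 0"
      using uv(3) graph_metricD(1)[OF D m(1,3)] graph_metricD(1)[OF E m(2,4)] by (auto simp: e)
    then have "max_metric D E u v = max_metric D E (x, y) v + 1"
      using x(3) y(3) by (auto simp: max_metric_def e)
    moreover have "(u, (x, y)) \<in> parcs (G \<boxtimes> H)"
      using x y m uv(3) by (auto simp: strong_product_def e)
    ultimately show ?thesis by blast
  qed
  moreover have "max_metric D E u v \<le> max_metric D E u' v + 1"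
    if a: "(u, u') \<in> parcs (G \<boxtimes> H)" and v: "v \<in> pverts (G \<boxtimes> H)" for u u' v
  proof -
    have "D (fst u) (fst v) \<le> D (fst u') (fst v) + 1" "E (snd u) (snd v) \<le> E (snd u') (snd v) + 1"
      using a v graph_metricD(3)[OF D] graph_metricD(3)[OF E]
      by (auto simp: strong_product_def)
    then show ?thesis by (auto simp: max_metric_def)
  qed
  ultimately show ?thesis
    unfolding graph_metric_def
    using graph_metricD(1,2)[OF D] graph_metricD(1,2)[OF E]
    by (auto simp: V max_metric_def)
qed

text \<open>
  Suppose that \<open>w\<close> is between \<open>u\<close> and \<open>v\<close>, and take a coordinate that realises the distance of \<open>u\<close>
  and \<open>v\<close>. The triangle inequality in this coordinate must be tight, so the same coordinate also
  realises the two positive distances to \<open>w\<close>. Hence its three values are distinct and violate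
  general position in that factor.
\<close>
lemma gp_set_times:
  assumes G: "pair_graph G" and D: "graph_metric G D"
    and H: "pair_graph H" and E: "graph_metric H E"
    and A: "A \<subseteq> pverts G" "gp_set D A" and B: "B \<subseteq> pverts H" "gp_set E B"
  shows "gp_set (max_metric D E) (A \<times> B)"
  unfolding gp_set_def
proof (intro ballI impI notI)
  fix u v w
  assume uvw: "u \<in> A \<times> B" "v \<in> A \<times> B" "w \<in> A \<times> B"
    and ne: "u \<noteq> v \<and> w \<noteq> u \<and> w \<noteq> v"
    and eq: "max_metric D E u v = max_metric D E u w + max_metric D E w v"
  obtain ux uy vx vy wx wy where e: "u = (ux, uy)" "v = (vx, vy)" "w = (wx, wy)" by (metis surj_pair)
  have mG: "ux \<in> pverts G" "vx \<in> pverts G" "wx \<in> pverts G"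
    and mH: "uy \<in> pverts H" "vy \<in> pverts H" "wy \<in> pverts H"
    using uvw A(1) B(1) by (auto simp: e)
  note zG = graph_metricD(1)[OF D mG(1,2)] graph_metricD(1)[OF D mG(1,3)]
    graph_metricD(1)[OF D mG(3,2)]
  note zH = graph_metricD(1)[OF E mH(1,2)] graph_metricD(1)[OF E mH(1,3)]
    graph_metricD(1)[OF E mH(3,2)]
  have pos: "max_metric D E u w > 0" "max_metric D E w v > 0"
    using ne zG zH by (auto simp: max_metric_def e)
  have tri: "D ux vx \<le> D ux wx + D wx vx" "E uy vy \<le> E uy wy + E wy vy"
    using graph_metric_triangle[OF D G mG] graph_metric_triangle[OF E H mH] by auto
  consider "max_metric D E u v = D ux vx" | "max_metric D E u v = E uy vy"
    by (cases "D ux vx \<le> E uy vy") (simp_all add: max_metric_def e)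
  then show False
  proof cases
    case 1
    have b: "D ux wx = max_metric D E u w" "D wx vx = max_metric D E w v"
      using 1 eq tri(1) by (auto simp: max_metric_def e)
    then have "D ux vx = D ux wx + D wx vx" "ux \<noteq> wx" "wx \<noteq> vx" "ux \<noteq> vx"
      using 1 eq pos zG by auto
    then show False using gp_setD[OF A(2), of ux vx wx] uvw by (auto simp: e)
  next
    case 2
    have b: "E uy wy = max_metric D E u w" "E wy vy = max_metric D E w v"
      using 2 eq tri(2) by (auto simp: max_metric_def e)
    then have "E uy vy = E uy wy + E wy vy" "uy \<noteq> wy" "wy \<noteq> vy" "uy \<noteq> vy"
      using 2 eq pos zH by auto
    then show False using gp_setD[OF B(2), of uy vy wy] uvw by (auto simp: e)
  qed
qed

text \<open>
  The coordinate \<open>p\<close> makes the first factor, as far as \<open>S\<close> uses it, a subset of a path. Then \<open>below\<close>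
  is a partial order whose comparable pairs have their distance realised along the path, and whose
  incomparable pairs have it realised in \<open>H\<close>. Three-element chains would be geodesics, so the
  points that have something below them form an antichain, as do the remaining points. Each
  antichain projects injectively to a general position set of \<open>H\<close>.
\<close>
lemma card_gp_set_path_product:
  fixes p :: "'a \<Rightarrow> nat"
  assumes H: "pair_graph H" and E: "graph_metric H E"
    and bound: "\<And>B. B \<subseteq> pverts H \<Longrightarrow> gp_set E B \<Longrightarrow> card B \<le> g"
    and fin: "finite S" and S: "snd ` S \<subseteq> pverts H" "gp_set (max_metric D E) S"
    and inj: "inj_on p (fst ` S)"
    and path: "\<And>x x'. x \<in> fst ` S \<Longrightarrow> x' \<in> fst ` S \<Longrightarrow> p x \<le> p x' \<Longrightarrow>
       D x x' = p x' - p x \<and> D x' x = p x' - p x"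
  shows "card S \<le> 2 * g"
proof -
  define below where "below u v \<longleftrightarrow> u \<noteq> v \<and> p (fst u) + E (snd u) (snd v) \<le> p (fst v)" for u v
  define M where "M = {v \<in> S. \<exists>u\<in>S. below u v}"
  have sym: "E (snd u) (snd v) = E (snd v) (snd u)" if "u \<in> S" "v \<in> S" for u v
    using graph_metricD(2)[OF E] S(1) that by blast
  have tri: "E (snd u) (snd v) \<le> E (snd u) (snd w) + E (snd w) (snd v)"
    if "u \<in> S" "v \<in> S" "w \<in> S" for u v w
    using graph_metric_triangle[OF E H] S(1) that by blast
  have zero: "E (snd u) (snd v) = 0 \<longleftrightarrow> snd u = snd v" if "u \<in> S" "v \<in> S" for u v
    using graph_metricD(1)[OF E] S(1) that by blast
  have lt: "p (fst u) < p (fst v)" if "u \<in> S" "v \<in> S" "below u v" for u v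
  proof (rule ccontr)
    assume "\<not> p (fst u) < p (fst v)"
    then have "p (fst u) = p (fst v)" "E (snd u) (snd v) = 0"
      using that(3) by (auto simp: below_def)
    then have "fst u = fst v" "snd u = snd v" using inj zero that by (auto dest: inj_onD)
    then show False using that(3) by (auto simp: below_def prod_eq_iff)
  qed
  have D_below: "max_metric D E u v = p (fst v) - p (fst u)"
    if "u \<in> S" "v \<in> S" "below u v" for u v
    using path[of "fst u" "fst v"] that by (auto simp: below_def max_metric_def)
  have no_chain: False if m: "u \<in> S" "w \<in> S" "v \<in> S" and b: "below u w" "below w v" for u w v
  proof -
    have l: "p (fst u) < p (fst w)" "p (fst w) < p (fst v)" using lt m b by auto
    have "below u v" using tri[OF m(1,3,2)] b l by (auto simp: below_def)
    then have "max_metric D E u v = max_metric D E u w + max_metric D E w v"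
      using D_below[OF m(1,3)] D_below[OF m(1,2) b(1)] D_below[OF m(2,3) b(2)] l by simp
    moreover have "u \<noteq> v" "w \<noteq> u" "w \<noteq> v" using l by auto
    ultimately show False using gp_setD[OF S(2) m(1,3,2)] by blast
  qed
  have antichain: "card A \<le> g"
    if A: "A \<subseteq> S" and anti: "\<And>u v. u \<in> A \<Longrightarrow> v \<in> A \<Longrightarrow> \<not> below u v" for A
  proof -
    have dom: "max_metric D E u v = E (snd u) (snd v) \<and> snd u \<noteq> snd v"
      if "u \<in> A" "v \<in> A" "u \<noteq> v" for u v
    proof -
      have m: "u \<in> S" "v \<in> S" using that A by auto
      have far: "p (fst u) + E (snd u) (snd v) > p (fst v)"
        "p (fst v) + E (snd u) (snd v) > p (fst u)"
        using anti[OF that(1,2)] anti[OF that(2,1)] that(3) sym[OF m]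
        by (auto simp: below_def)
      then have "E (snd u) (snd v) > 0" by linarith
      moreover have "D (fst u) (fst v) < E (snd u) (snd v)"
        using path[of "fst u" "fst v"] path[of "fst v" "fst u"] m far
        by (cases "p (fst u) \<le> p (fst v)") auto
      ultimately show ?thesis using zero[OF m] by (auto simp: max_metric_def)
    qed
    then have "inj_on snd A" by (intro inj_onI) blast
    have "gp_set E (snd ` A)"
      unfolding gp_set_def
    proof (clarify)
      fix ux uy vx vy wx wy
      assume m: "(ux, uy) \<in> A" "(vx, vy) \<in> A" "(wx, wy) \<in> A"
        and ne: "snd (ux, uy) \<noteq> snd (vx, vy)" "snd (wx, wy) \<noteq> snd (ux, uy)"
          "snd (wx, wy) \<noteq> snd (vx, vy)"
        and "E (snd (ux, uy)) (snd (vx, vy)) =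
          E (snd (ux, uy)) (snd (wx, wy)) + E (snd (wx, wy)) (snd (vx, vy))"
      then show False
        using gp_setD[OF S(2), of "(ux, uy)" "(vx, vy)" "(wx, wy)"] A
          dom[OF m(1,2)] dom[OF m(1,3)] dom[OF m(3,2)] by auto
    qed
    moreover have "snd ` A \<subseteq> pverts H" using A S(1) by blast
    ultimately have "card (snd ` A) \<le> g" using bound by simp
    then show ?thesis using \<open>inj_on snd A\<close> by (simp add: card_image)
  qed
  have "card M \<le> g"
    by (rule antichain) (use no_chain in \<open>auto simp: M_def\<close>)
  moreover have "card (S - M) \<le> g"
    by (rule antichain) (auto simp: M_def)
  moreover have "card S = card M + card (S - M)"
    using fin by (simp add: M_def card_Diff_subset card_mono)
  ultimately show ?thesis by simp
qed

section \<open>Cycles\<close>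

definition cycle_metric :: "nat \<Rightarrow> nat \<Rightarrow> nat \<Rightarrow> nat" where
  "cycle_metric n i j = (let k = (if i \<le> j then j - i else i - j) in min k (n - k))"

lemma pverts_cycle_graph [simp]: "pverts (cycle_graph n) = {0..<n}"
  by (simp add: cycle_graph_def)

lemma cycle_metric_near:
  "i \<le> j \<Longrightarrow> 2 * j \<le> n + 2 * i \<Longrightarrow> cycle_metric n i j = j - i"
  by (simp add: cycle_metric_def Let_def)

lemma cycle_metric_far:
  "i \<le> j \<Longrightarrow> n + 2 * i \<le> 2 * j \<Longrightarrow> cycle_metric n i j = n + i - j"
  by (simp add: cycle_metric_def Let_def)

lemma cycle_metric_commute: "cycle_metric n i j = cycle_metric n j i"
  by (simp add: cycle_metric_def)

lemma cycle_metric_Suc_le: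
  assumes "Suc i < n" "j < n"
  shows "cycle_metric n i j \<le> cycle_metric n (Suc i) j + 1"
    and "cycle_metric n (Suc i) j \<le> cycle_metric n i j + 1"
proof -
  consider "i < j" | "j \<le> i" by linarith
  then show "cycle_metric n i j \<le> cycle_metric n (Suc i) j + 1"
    and "cycle_metric n (Suc i) j \<le> cycle_metric n i j + 1"
    using assms by (cases; auto simp: cycle_metric_def Let_def min_def)+
qed

lemma cycle_metric_wrap_le:
  assumes "j < n"
  shows "cycle_metric n (n - 1) j \<le> cycle_metric n 0 j + 1"
    and "cycle_metric n 0 j \<le> cycle_metric n (n - 1) j + 1"
  using assms by (auto simp: cycle_metric_def Let_def min_def)

text \<open>
  Of the two neighbours of \<open>i\<close>, the one on a shortest arc to \<open>j\<close> is closer to \<open>j\<close>. In the second and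
  the fifth case this neighbour is reached through the arc between \<open>n - 1\<close> and \<open>0\<close>.
\<close>
lemma cycle_metric_step:
  assumes ij: "i < n" "j < n" "i \<noteq> j"
  shows "cycle_metric n i j = cycle_metric n (if i + 1 = n then 0 else i + 1) j + 1 \<or>
         cycle_metric n i j = cycle_metric n (if i = 0 then n - 1 else i - 1) j + 1"
proof -
  consider "i < j" "2 * j \<le> n + 2 * i" | "i < j" "n + 2 * i < 2 * j" "i = 0"
    | "i < j" "n + 2 * i < 2 * j" "i > 0" | "j < i" "2 * i \<le> n + 2 * j"
    | "j < i" "n + 2 * j < 2 * i" "i + 1 = n" | "j < i" "n + 2 * j < 2 * i" "i + 1 < n"
    using ij by linarith
  then show ?thesis
  proof cases
    case 1
    then have "cycle_metric n i j = cycle_metric n (i + 1) j + 1"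
      by (simp add: cycle_metric_near)
    then show ?thesis using 1 ij by simp
  next
    case 2
    then have "cycle_metric n 0 j = n - j" by (simp add: cycle_metric_far)
    moreover have "cycle_metric n (n - 1) j = n - 1 - j"
      using 2 ij by (simp add: cycle_metric_near cycle_metric_commute[of n _ j])
    ultimately show ?thesis using 2 ij by (simp add: Suc_diff_Suc)
  next
    case 3
    then have "cycle_metric n i j = cycle_metric n (i - 1) j + 1"
      using ij by (simp add: cycle_metric_far)
    then show ?thesis using 3 by simp
  next
    case 4
    then have "cycle_metric n i j = cycle_metric n (i - 1) j + 1"
      by (simp add: cycle_metric_near cycle_metric_commute[of n _ j])
    then show ?thesis using 4 by simp
  next
    case 5
    then have "cycle_metric n i j = j + 1" "cycle_metric n 0 j = j"
      by (simp_all add: cycle_metric_near cycle_metric_far cycle_metric_commute[of n i])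
    then show ?thesis using 5 by simp
  next
    case 6
    then have "cycle_metric n i j = cycle_metric n (i + 1) j + 1"
      by (simp add: cycle_metric_far cycle_metric_commute[of n _ j])
    then show ?thesis using 6 by simp
  qed
qed

lemma graph_metric_cycle:
  assumes n: "n \<ge> 3"
  shows "graph_metric (cycle_graph n) (cycle_metric n)"
proof -
  have arcs: "(i, j) \<in> parcs (cycle_graph n) \<longleftrightarrow>
      i < n \<and> j < n \<and> (j = i + 1 \<or> i = j + 1 \<or> i + 1 = n \<and> j = 0 \<or> j + 1 = n \<and> i = 0)" for i j
    using n by (auto simp: cycle_graph_def mod_Suc)
  have "\<exists>i'. (i, i') \<in> parcs (cycle_graph n) \<and> cycle_metric n i j = cycle_metric n i' j + 1"
    if ij: "i < n" "j < n" "i \<noteq> j" for i j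
  proof -
    have "(i, if i + 1 = n then 0 else i + 1) \<in> parcs (cycle_graph n)"
      "(i, if i = 0 then n - 1 else i - 1) \<in> parcs (cycle_graph n)"
      using ij n by (auto simp: arcs)
    then show ?thesis using cycle_metric_step[OF ij] by blast
  qed
  moreover have "cycle_metric n i j \<le> cycle_metric n i' j + 1"
    if arc: "(i, i') \<in> parcs (cycle_graph n)" and j: "j < n" for i i' j
  proof -
    consider "i' = Suc i" "Suc i < n" | "i = Suc i'" "Suc i' < n"
      | "i = n - 1" "i' = 0" | "i' = n - 1" "i = 0"
      using arc by (auto simp: arcs)
    then show ?thesis
      by cases (use cycle_metric_Suc_le cycle_metric_wrap_le j in auto)
  qed
  moreover have "cycle_metric n i j = 0 \<longleftrightarrow> i = j" if "i < n" "j < n" for i j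
    using that by (auto simp: cycle_metric_def Let_def)
  ultimately show ?thesis
    unfolding graph_metric_def by (simp add: cycle_metric_commute)
qed

text \<open>
  Consider four points in cyclic order. One of the two arcs from the first to the third is a
  geodesic, and it contains the second or the fourth point.
\<close>
lemma card_gp_set_cycle:
  assumes B: "B \<subseteq> {0..<n}" and gp: "gp_set (cycle_metric n) B"
  shows "card B \<le> 3"
proof (rule ccontr)
  assume "\<not> card B \<le> 3"
  moreover have fin: "finite B" using B finite_subset by blast
  ultimately have len: "length (sorted_list_of_set B) \<ge> 4" by simp
  define b where "b i = sorted_list_of_set B ! i" for i
  have mem: "b i \<in> B" if "i < 4" for i
    using that len nth_mem[of i "sorted_list_of_set B"] fin by (simp add: b_def)
  have less: "b i < b j" if "i < j" "j < 4" for i j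
    using that len sorted_wrt_nth_less[OF strict_sorted_list_of_set[of B], of i j]
    by (simp add: b_def)
  have ord: "b 0 < b 1" "b 1 < b 2" "b 2 < b 3" and top: "b 3 < n"
    using less mem[of 3] B by auto
  have "cycle_metric n (b 0) (b 2) = cycle_metric n (b 0) (b 1) + cycle_metric n (b 1) (b 2) \<or>
      cycle_metric n (b 2) (b 0) = cycle_metric n (b 2) (b 3) + cycle_metric n (b 3) (b 0)"
  proof (cases "2 * b 2 \<le> n + 2 * b 0")
    case True
    then show ?thesis using ord by (simp add: cycle_metric_near)
  next
    case False
    then have "cycle_metric n (b 2) (b 0) = n + b 0 - b 2"
      "cycle_metric n (b 3) (b 0) = n + b 0 - b 3" "cycle_metric n (b 2) (b 3) = b 3 - b 2"
      using ord top
      by (simp_all add: cycle_metric_near cycle_metric_far cycle_metric_commute[of n _ "b 0"])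
    then show ?thesis using ord top by simp
  qed
  then show False
    using gp_setD[OF gp, of "b 0" "b 2" "b 1"] gp_setD[OF gp, of "b 2" "b 0" "b 3"]
      mem[of 0] mem[of 1] mem[of 2] mem[of 3] ord by auto
qed

text \<open>
  The points \<open>0\<close>, \<open>a\<close>, \<open>b\<close> cut the cycle into two arcs of length \<open>(n - 1) div 2\<close> and one of length 1
  or 2. All three are shorter than \<open>n / 2\<close>, so no distance is the sum of the other two. For
  \<open>n = 4\<close> the arc of length 2 is too long.
\<close>
lemma gp_set_cycle_exists:
  assumes n: "n \<ge> 3" "n \<noteq> 4"
  shows "\<exists>A. A \<subseteq> {0..<n} \<and> gp_set (cycle_metric n) A \<and> card A = 3"
proof -
  define a b where "a = (n - 1) div 2" and "b = n div 2 + 1"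
  have ab: "0 < a" "a < b" "b < n" "2 * a < n" "n < 2 * b" "2 * (b - a) < n"
    using n unfolding a_def b_def by presburger+
  have dist: "cycle_metric n 0 a = a" "cycle_metric n 0 b = n - b" "cycle_metric n a b = b - a"
    "cycle_metric n a 0 = a" "cycle_metric n b 0 = n - b" "cycle_metric n b a = b - a"
    using ab by (simp_all add: cycle_metric_near cycle_metric_far
        cycle_metric_commute[of n _ 0] cycle_metric_commute[of n b a])
  have "gp_set (cycle_metric n) {0, a, b}"
    unfolding gp_set_def using ab dist by auto
  moreover have "card {0, a, b} = 3" using ab by auto
  ultimately show ?thesis using ab by (intro exI[of _ "{0, a, b}"]) auto
qed

text \<open>
  The number of steps from \<open>s\<close> forward to \<open>x\<close> around the cycle. The \<open>x\<close> with offset at most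
  \<open>n div 2\<close> form the window starting at \<open>s\<close>, on which the offset is a path coordinate because the
  window spans no more than half of the cycle.
\<close>
definition offset :: "nat \<Rightarrow> nat \<Rightarrow> nat \<Rightarrow> nat" where
  "offset n s x = (if s \<le> x then x - s else x + n - s)"

lemma cycle_metric_offset:
  assumes "s < n" "x < n" "x' < n"
    and "offset n s x \<le> offset n s x'" and "offset n s x' \<le> n div 2"
  shows "cycle_metric n x x' = offset n s x' - offset n s x"
proof -
  have half: "2 * offset n s x' \<le> n" using assms(5) by linarith
  consider "s \<le> x" "s \<le> x'" | "x < s" "x' < s" | "s \<le> x" "x' < s" | "x < s" "s \<le> x'"
    by linarith
  then show ?thesis
  proof cases
    case 3
    then show ?thesis
      using assms half
      by (simp add: offset_def cycle_metric_commute[of n x] cycle_metric_far)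
  qed (use assms half in \<open>simp_all add: offset_def cycle_metric_near\<close>)
qed

text \<open>
  For fixed \<open>x\<close> the map \<open>s \<mapsto> offset n s x\<close> is an involution, since it is \<open>s \<mapsto> x - s\<close> modulo \<open>n\<close>.
\<close>
lemma card_offset_le:
  assumes x: "x < n" and k: "k < n"
  shows "card {s \<in> {..<n}. offset n s x \<le> k} = k + 1"
proof -
  have inv: "offset n s x < n" "offset n (offset n s x) x = s" if "s < n" for s
    using that x by (auto simp: offset_def)
  have "bij_betw (\<lambda>s. offset n s x) {s \<in> {..<n}. offset n s x \<le> k} {..k}"
    by (rule bij_betw_byWitness[where f' = "\<lambda>s. offset n s x"]) (use inv k in auto)
  then show ?thesis using bij_betw_same_card by fastforce
qed

text \<open>
  Average over the \<open>n\<close> windows: each contains at most \<open>2 * g\<close> points of \<open>S\<close>, and each point of \<open>S\<close>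
  lies over \<open>n div 2 + 1\<close> of them.
\<close>
lemma card_gp_set_cycle_product:
  assumes n: "n \<ge> 3" and H: "pair_graph H" and E: "graph_metric H E"
    and bound: "\<And>B. B \<subseteq> pverts H \<Longrightarrow> gp_set E B \<Longrightarrow> card B \<le> g"
    and S: "S \<subseteq> {0..<n} \<times> pverts H" "gp_set (max_metric (cycle_metric n) E) S"
  shows "card S * (n div 2 + 1) \<le> n * (2 * g)"
proof -
  have "finite (pverts H)"
    using H by (auto simp: pair_graph_def pair_digraph_def pair_fin_digraph_def
        pair_fin_digraph_axioms_def)
  then have fin: "finite S" using S(1) by (meson finite_SigmaI finite_atLeastLessThan finite_subset)
  define W where "W s = {u \<in> S. offset n s (fst u) \<le> n div 2}" for s
  have window: "card (W s) \<le> 2 * g" if s: "s < n" for s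
  proof (rule card_gp_set_path_product[OF H E bound])
    show "finite (W s)" using fin by (simp add: W_def)
    show "snd ` W s \<subseteq> pverts H" using S(1) by (auto simp: W_def)
    show "gp_set (max_metric (cycle_metric n) E) (W s)"
      by (rule gp_set_subset[OF S(2)]) (auto simp: W_def)
    have m: "x < n \<and> offset n s x \<le> n div 2" if "x \<in> fst ` W s" for x
      using that S(1) by (auto simp: W_def)
    show "inj_on (offset n s) (fst ` W s)"
      using m s by (intro inj_onI) (force simp: offset_def split: if_splits)
    show "cycle_metric n x x' = offset n s x' - offset n s x \<and>
        cycle_metric n x' x = offset n s x' - offset n s x"
      if "x \<in> fst ` W s" "x' \<in> fst ` W s" "offset n s x \<le> offset n s x'" for x x'
      using cycle_metric_offset[OF s] cycle_metric_commute m that by metis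
  qed auto
  have "card S * (n div 2 + 1) = (\<Sum>u\<in>S. card {s \<in> {..<n}. offset n s (fst u) \<le> n div 2})"
    using S(1) n by (subst sum.cong[OF refl card_offset_le]) auto
  also have "\<dots> = (\<Sum>s<n. card (W s))"
    unfolding W_def by (rule sum_multicount_gen[symmetric]) (use fin in auto)
  also have "\<dots> \<le> n * (2 * g)"
    using sum_bounded_above[of "{..<n}" "\<lambda>s. card (W s)" "2 * g"] window by simp
  finally show ?thesis .
qed

section \<open>The general position number\<close>

theorem corollary4p2:
  fixes t :: nat
  assumes "t \<ge> 3" and "t \<noteq> 4"
  shows "gp_number (cycle_graph 8 \<boxtimes> cycle_graph t) = 9"
proof -
  let ?D = "max_metric (cycle_metric 8) (cycle_metric t)"
  note C8 = pair_graph_cycle_graph[of 8, simplified] graph_metric_cycle[of 8, simplified]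
  note Ct = pair_graph_cycle_graph[OF assms(1)] graph_metric_cycle[OF assms(1)]
  have V: "pverts (cycle_graph 8 \<boxtimes> cycle_graph t) = {0..<8} \<times> {0..<t}"
    by (simp add: strong_product_def)
  have gp: "general_position (cycle_graph 8 \<boxtimes> cycle_graph t) S \<longleftrightarrow>
      S \<subseteq> {0..<8} \<times> {0..<t} \<and> gp_set ?D S" for S
    using general_position_iff_gp_set[OF pair_graph_strong_product[OF C8(1) Ct(1)]
        graph_metric_strong_product[OF C8 Ct]] assms(1) by (auto simp: V)
  have upper: "card S \<le> 9" if "S \<subseteq> {0..<8} \<times> {0..<t}" "gp_set ?D S" for S
    using card_gp_set_cycle_product[OF _ Ct, of 8 3 S] card_gp_set_cycle[of _ t] that by simp
  obtain A where A: "A \<subseteq> {0..<8}" "gp_set (cycle_metric 8) A" "card A = 3"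
    using gp_set_cycle_exists[of 8] by auto
  obtain B where B: "B \<subseteq> {0..<t}" "gp_set (cycle_metric t) B" "card B = 3"
    using gp_set_cycle_exists[OF assms] by auto
  have "gp_set ?D (A \<times> B)" using gp_set_times[OF C8 Ct] A B by simp
  moreover have "A \<times> B \<subseteq> {0..<8} \<times> {0..<t}" using A B by blast
  moreover have "card (A \<times> B) = 9" using A B by (simp add: card_cartesian_product)
  ultimately have "9 \<in> card ` {S. general_position (cycle_graph 8 \<boxtimes> cycle_graph t) S}"
    unfolding gp by (metis (mono_tags, lifting) image_eqI mem_Collect_eq)
  moreover have fin: "finite {S. general_position (cycle_graph 8 \<boxtimes> cycle_graph t) S}"
    unfolding gp by (rule finite_subset[of _ "Pow ({0..<8} \<times> {0..<t})"]) auto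
  ultimately show ?thesis
    unfolding gp_number_def using upper by (intro Max_eqI finite_imageI[OF fin]) (auto simp: gp)
qed

end
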